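(* Let $O$ be a $\lambda$-term with $x\notin FV(O)$, and let $\mathcal{T}$ be any $\lambda$-theory containing the equations $\Theta x O = x$ and $\Theta xx = O$. Then $\mathcal{T}\vdash O = Y(\lambda x.x)$ for every fixpoint combinator $Y$. In particular, if $Y \equiv \lambda f.(\lambda x.f(xx))(\lambda x.f(xx))$ is Curry's fixpoint combinator, then $\mathcal{T}\vdash O = \Omega$.
   Context: A $\lambda$-theory is a congruence on $\lambda$-terms (w.r.t. application and abstraction) containing $\alpha\beta$-conversion. A fixpoint combinator is a closed term $Y$ with $YM =_\beta M(YM)$ for all terms $M$. $\Omega \equiv (\lambda x.xx)(\lambda x.xx)$, $B \equiv \lambda x.x(\lambda y.yx)$, $C \equiv \lambda z.zB$, $\Theta \equiv BC$. *)

theory Defs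
  imports Main
begin

type_synonym var = nat

datatype lterm =
    Var var
  | App lterm lterm  (infixl "\<cdot>" 200)
  | Lam var lterm

primrec FV :: "lterm \<Rightarrow> var set" where
  "FV (Var x) = {x}"
| "FV (M \<cdot> N) = FV M \<union> FV N"
| "FV (Lam x M) = FV M - {x}"

definition fresh_name :: "var \<Rightarrow> var set \<Rightarrow> var" where
  "fresh_name y A = (if y \<notin> A then y else (LEAST z. z \<notin> A))"

text \<open>
  Simultaneous capture-avoiding substitution on raw (named) terms. A bound variable is kept
  unless it would capture a variable of a substituted term. Making the substitution simultaneous
  lets the renaming of the bound variable and the substitution itself be carried out in a single
  structural recursion.
\<close>
primrec msubst :: "(var \<Rightarrow> lterm) \<Rightarrow> lterm \<Rightarrow> lterm" where
  "msubst \<sigma> (Var x) = \<sigma> x"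
| "msubst \<sigma> (M \<cdot> N) = msubst \<sigma> M \<cdot> msubst \<sigma> N"
| "msubst \<sigma> (Lam y M) =
     (let z = fresh_name y (\<Union>v\<in>FV M - {y}. FV (\<sigma> v))
      in Lam z (msubst (\<sigma>(y := Var z)) M))"

definition subst :: "lterm \<Rightarrow> var \<Rightarrow> lterm \<Rightarrow> lterm"  ("_[_ ::= _]" [1000, 0, 0] 1000) where
  "M[x ::= N] = msubst (Var(x := N)) M"

text \<open>
  Terms are not quotiented by \<open>\<alpha>\<close>-equivalence, so \<open>=\<^sub>\<beta>\<close> includes the \<open>\<alpha>\<close>-rule explicitly.
\<close>
inductive beta_conv :: "lterm \<Rightarrow> lterm \<Rightarrow> bool"  (infix "=\<^sub>\<beta>" 50) where
  alpha: "y \<notin> FV M \<Longrightarrow> Lam x M =\<^sub>\<beta> Lam y (M[x ::= Var y])"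
| beta:  "Lam x M \<cdot> N =\<^sub>\<beta> M[x ::= N]"
| refl:  "M =\<^sub>\<beta> M"
| sym:   "M =\<^sub>\<beta> N \<Longrightarrow> N =\<^sub>\<beta> M"
| trans: "M =\<^sub>\<beta> N \<Longrightarrow> N =\<^sub>\<beta> P \<Longrightarrow> M =\<^sub>\<beta> P"
| app:   "M =\<^sub>\<beta> M' \<Longrightarrow> N =\<^sub>\<beta> N' \<Longrightarrow> M \<cdot> N =\<^sub>\<beta> M' \<cdot> N'"
| lam:   "M =\<^sub>\<beta> M' \<Longrightarrow> Lam x M =\<^sub>\<beta> Lam x M'"

definition congruence :: "(lterm \<times> lterm) set \<Rightarrow> bool" where
  "congruence T \<longleftrightarrow>
     equiv UNIV T \<and>
     (\<forall>M M' N N'. (M, M') \<in> T \<longrightarrow> (N, N') \<in> T \<longrightarrow> (M \<cdot> N, M' \<cdot> N') \<in> T) \<and>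
     (\<forall>x M M'. (M, M') \<in> T \<longrightarrow> (Lam x M, Lam x M') \<in> T)"

definition lambda_theory :: "(lterm \<times> lterm) set \<Rightarrow> bool" where
  "lambda_theory T \<longleftrightarrow> congruence T \<and> {(M, N). M =\<^sub>\<beta> N} \<subseteq> T"

abbreviation derives :: "(lterm \<times> lterm) set \<Rightarrow> lterm \<Rightarrow> lterm \<Rightarrow> bool"
    ("_ \<turnstile> _ \<approx> _" [51, 51, 51] 50) where
  "T \<turnstile> M \<approx> N \<equiv> (M, N) \<in> T"

definition fixpoint_combinator :: "lterm \<Rightarrow> bool" where
  "fixpoint_combinator Y \<longleftrightarrow> FV Y = {} \<and> (\<forall>M. Y \<cdot> M =\<^sub>\<beta> M \<cdot> (Y \<cdot> M))"

definition Omega :: lterm where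
  "Omega = Lam 0 (Var 0 \<cdot> Var 0) \<cdot> Lam 0 (Var 0 \<cdot> Var 0)"

definition comb_B :: lterm where
  "comb_B = Lam 0 (Var 0 \<cdot> Lam 1 (Var 1 \<cdot> Var 0))"

definition comb_C :: lterm where
  "comb_C = Lam 0 (Var 0 \<cdot> comb_B)"

definition Theta :: lterm where
  "Theta = comb_B \<cdot> comb_C"

definition Curry_Y :: lterm where
  "Curry_Y = Lam 0 (Lam 1 (Var 0 \<cdot> (Var 1 \<cdot> Var 1)) \<cdot> Lam 1 (Var 0 \<cdot> (Var 1 \<cdot> Var 1)))"

end

theory Submission
  imports Defs
begin

text \<open>
  The argument only uses \<open>\<Theta>\<close> as a closed binary operation \<open>s\<close> with \<open>s(x, O) = x\<close> and
  \<open>s(x, x) = O\<close>. Put \<open>A(z) = Y(\<lambda>x. s(x, z))\<close>, so that \<open>A(z) = s(A(z), z)\<close>, and let \<open>P = Y A\<close>, so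
  that \<open>P = A(P)\<close>. Then \<open>P = s(A(P), P) = s(P, P) = O\<close>, and therefore
  \<open>O = A(O) = Y(\<lambda>x. s(x, O)) = Y(\<lambda>x. x)\<close>.
\<close>

lemma finite_FV: "finite (FV M)"
  by (induction M) auto

lemma fresh_name_notin: "finite A \<Longrightarrow> fresh_name y A \<notin> A"
  unfolding fresh_name_def by (metis LeastI_ex ex_new_if_finite infinite_UNIV_nat)

lemma fresh_name_same: "y \<notin> A \<Longrightarrow> fresh_name y A = y"
  by (simp add: fresh_name_def)

text \<open>The equality is literal, not just up to \<alpha>: under the hypothesis, the names to
  avoid below \<open>Lam y\<close> are those in \<open>FV M - {y}\<close>, so
  \<open>fresh_name\<close> keeps \<open>y\<close>.\<close>

lemma msubst_id: "(\<And>v. v \<in> FV M \<Longrightarrow> \<sigma> v = Var v) \<Longrightarrow> msubst \<sigma> M = M"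
proof (induction M arbitrary: \<sigma>)
  case (Lam y M)
  have "(\<Union>v\<in>FV M - {y}. FV (\<sigma> v)) = FV M - {y}"
    using Lam.prems by auto
  moreover have "msubst (\<sigma>(y := Var y)) M = M"
    using Lam.prems by (intro Lam.IH) auto
  ultimately show ?case
    by (simp add: fresh_name_same)
qed auto

lemma subst_fresh: "x \<notin> FV M \<Longrightarrow> M[x ::= N] = M"
  unfolding subst_def by (rule msubst_id) auto

lemma msubst_closed: "FV M = {} \<Longrightarrow> msubst \<sigma> M = M"
  by (rule msubst_id) simp

lemma FV_Theta: "FV Theta = {}"
  by (auto simp: Theta_def comb_B_def comb_C_def)

lemma lambda_theory_beta: "lambda_theory T \<Longrightarrow> M =\<^sub>\<beta> N \<Longrightarrow> T \<turnstile> M \<approx> N"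
  by (auto simp: lambda_theory_def)

lemma lambda_theory_sym: "lambda_theory T \<Longrightarrow> T \<turnstile> M \<approx> N \<Longrightarrow> T \<turnstile> N \<approx> M"
  unfolding lambda_theory_def congruence_def by (meson equivE symE)

lemma lambda_theory_trans:
  "lambda_theory T \<Longrightarrow> T \<turnstile> M \<approx> N \<Longrightarrow> T \<turnstile> N \<approx> P \<Longrightarrow> T \<turnstile> M \<approx> P"
  unfolding lambda_theory_def congruence_def by (meson equivE transE)

lemma lambda_theory_app:
  "lambda_theory T \<Longrightarrow> T \<turnstile> M \<approx> M' \<Longrightarrow> T \<turnstile> N \<approx> N' \<Longrightarrow> T \<turnstile> M \<cdot> N \<approx> M' \<cdot> N'"
  unfolding lambda_theory_def congruence_def by blast

lemma lambda_theory_lam: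
  "lambda_theory T \<Longrightarrow> T \<turnstile> M \<approx> M' \<Longrightarrow> T \<turnstile> Lam x M \<approx> Lam x M'"
  unfolding lambda_theory_def congruence_def by blast

text \<open>Both instances are \<beta>-contracta of redexes \<open>Lam x M \<cdot> P\<close> and
  \<open>Lam x N \<cdot> P\<close>, which the congruence rules identify.\<close>

lemma lambda_theory_subst:
  assumes T: "lambda_theory T" and eq: "T \<turnstile> M \<approx> N"
  shows "T \<turnstile> M[x ::= P] \<approx> N[x ::= P]"
proof -
  have "T \<turnstile> M[x ::= P] \<approx> Lam x M \<cdot> P"
    by (intro lambda_theory_beta[OF T] beta_conv.sym[OF beta_conv.beta])
  moreover have "T \<turnstile> Lam x M \<cdot> P \<approx> Lam x N \<cdot> P"
    by (intro lambda_theory_app[OF T] lambda_theory_lam[OF T] eq lambda_theory_beta[OF T]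
        beta_conv.refl)
  moreover have "T \<turnstile> Lam x N \<cdot> P \<approx> N[x ::= P]"
    by (intro lambda_theory_beta[OF T] beta_conv.beta)
  ultimately show ?thesis
    by (blast intro: lambda_theory_trans[OF T])
qed

text \<open>Replacing \<open>Theta\<close> by a closed \<open>S\<close> lets substitutions pass over
  it by \<open>msubst_closed\<close>, with no unfolding of combinators.\<close>

lemma subtractive_zero_eq_fixpoint_identity:
  assumes T: "lambda_theory T"
    and S: "FV S = {}"
    and x: "x \<notin> FV Z"
    and zero: "T \<turnstile> S \<cdot> Var x \<cdot> Z \<approx> Var x"
    and diag: "T \<turnstile> S \<cdot> Var x \<cdot> Var x \<approx> Z"
    and Y: "fixpoint_combinator Y"
  shows "T \<turnstile> Z \<approx> Y \<cdot> Lam x (Var x)"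
proof -
  note refl = lambda_theory_beta[OF T beta_conv.refl]
    and app = lambda_theory_app[OF T]
    and lam = lambda_theory_lam[OF T]
    and sym = lambda_theory_sym[OF T]
    and trans = lambda_theory_trans[OF T]
  have FV_Y: "FV Y = {}" and fixpoint: "Y \<cdot> M =\<^sub>\<beta> M \<cdot> (Y \<cdot> M)" for M
    using Y by (auto simp: fixpoint_combinator_def)
  \<comment> \<open>Any name other than \<open>x\<close> would do; \<open>x\<close> is reserved for
    the inner binder so that \<open>zero\<close> applies directly beneath it.\<close>
  define z where "z = Suc x"
  define A where "A = Lam z (Y \<cdot> Lam x (S \<cdot> Var x \<cdot> Var z))"
  define P where "P = Y \<cdot> A"
  \<comment> \<open>This is what the inner abstraction of \<open>A\<close> becomes once
    \<open>P\<close> replaces \<open>z\<close>.\<close>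
  define F where "F = Lam x (S \<cdot> Var x \<cdot> P)"
  have zx: "z \<noteq> x" "x \<noteq> z"
    by (simp_all add: z_def)
  \<comment> \<open>Closedness of \<open>P\<close> means that moving it under \<open>Lam x\<close>
    forces no renaming, and that substituting for \<open>x\<close> leaves it unchanged.\<close>
  have P_closed: "FV P = {}"
    using zx by (auto simp: P_def A_def FV_Y S)
  have "A \<cdot> P =\<^sub>\<beta> (Y \<cdot> Lam x (S \<cdot> Var x \<cdot> Var z))[z ::= P]"
    unfolding A_def by (rule beta_conv.beta)
  also have "(Y \<cdot> Lam x (S \<cdot> Var x \<cdot> Var z))[z ::= P] = Y \<cdot> F"
  proof -
    have "fresh_name x (\<Union>v\<in>FV (S \<cdot> Var x \<cdot> Var z) - {x}. FV ((Var(z := P)) v)) = x"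
      using zx by (intro fresh_name_same) (auto simp: S P_closed)
    then show ?thesis
      using zx by (simp add: subst_def F_def msubst_closed FV_Y S Let_def del: FV.simps)
  qed
  \<comment> \<open>One unfolding of the fixpoint \<open>P = Y \<cdot> A\<close> gives
    \<open>A \<cdot> P\<close>, which has just been reduced to \<open>Y \<cdot> F\<close>.\<close>
  finally have P_eq: "T \<turnstile> P \<approx> Y \<cdot> F"
    by (metis P_def T fixpoint beta_conv.trans lambda_theory_beta)
  have "F \<cdot> (Y \<cdot> F) =\<^sub>\<beta> S \<cdot> (Y \<cdot> F) \<cdot> P"
    using beta_conv.beta[of x "S \<cdot> Var x \<cdot> P" "Y \<cdot> F"]
    by (simp add: subst_def msubst_closed S P_closed F_def[symmetric])
  then have "T \<turnstile> Y \<cdot> F \<approx> S \<cdot> (Y \<cdot> F) \<cdot> P"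
    by (meson T fixpoint beta_conv.trans lambda_theory_beta)
  moreover have "T \<turnstile> S \<cdot> (Y \<cdot> F) \<cdot> P \<approx> S \<cdot> P \<cdot> P"
    by (intro app refl sym[OF P_eq])
  \<comment> \<open>The law \<open>diag\<close> speaks of a variable; substitution transfers it to
    \<open>P\<close>, while \<open>x \<notin> FV Z\<close> keeps \<open>Z\<close> fixed.\<close>
  moreover have "T \<turnstile> S \<cdot> P \<cdot> P \<approx> Z"
    using lambda_theory_subst[OF T diag, of x P] x
    by (simp add: subst_fresh) (simp add: subst_def msubst_closed S)
  ultimately have P_Z: "T \<turnstile> P \<approx> Z"
    by (blast intro: trans P_eq)
  \<comment> \<open>Under the binder, \<open>P\<close> is replaced by \<open>Z\<close>, and
    \<open>zero\<close> then collapses the body to \<open>Var x\<close>.\<close>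
  have "T \<turnstile> Y \<cdot> F \<approx> Y \<cdot> Lam x (Var x)"
    unfolding F_def by (intro app lam refl trans[OF app[OF refl P_Z] zero])
  then show ?thesis
    by (blast intro: trans sym P_Z P_eq)
qed

text \<open>\<open>Curry_Y \<cdot> M\<close> and \<open>M \<cdot> (Curry_Y \<cdot> M)\<close> meet
  at \<open>M \<cdot> (W \<cdot> W)\<close>, where \<open>W\<close> is the self-application term for
  \<open>M\<close>.\<close>

lemma fixpoint_combinator_Curry_Y: "fixpoint_combinator Curry_Y"
proof -
  have "Curry_Y \<cdot> M =\<^sub>\<beta> M \<cdot> (Curry_Y \<cdot> M)" for M
  proof -
    \<comment> \<open>This is the very name that \<open>msubst\<close> gives the inner binder
      \<open>1\<close> when \<open>M\<close> is substituted for \<open>0\<close>; it differs from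
      \<open>1\<close> only if \<open>1\<close> is free in \<open>M\<close>.\<close>
    define z where "z = fresh_name 1 (FV M)"
    define W where "W = Lam z (M \<cdot> (Var z \<cdot> Var z))"
    have z: "z \<notin> FV M"
      by (simp add: z_def fresh_name_notin finite_FV)
    \<comment> \<open>This evaluates the index set of the union in \<open>msubst\<close>: only
      variable \<open>0\<close> is free under the binder, so the names to avoid are those in
      \<open>FV M\<close>.\<close>
    have "{0, 1} - {1} = {0::nat}"
      by auto
    then have unfold: "Curry_Y \<cdot> M =\<^sub>\<beta> W \<cdot> W"
      using beta_conv.beta[of 0 "Lam 1 (Var 0 \<cdot> (Var 1 \<cdot> Var 1)) \<cdot> Lam 1 (Var 0 \<cdot> (Var 1 \<cdot> Var 1))" M]
      by (simp add: subst_def Curry_Y_def W_def z_def Let_def)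
    have "msubst (Var(z := W)) M = M"
      using z subst_fresh[of z M W] by (simp add: subst_def)
    then have "W \<cdot> W =\<^sub>\<beta> M \<cdot> (W \<cdot> W)"
      using beta_conv.beta[of z "M \<cdot> (Var z \<cdot> Var z)" W]
      by (simp add: subst_def W_def[symmetric])
    then show ?thesis
      using unfold by (meson beta_conv.app beta_conv.refl beta_conv.sym beta_conv.trans)
  qed
  then show ?thesis
    by (auto simp: fixpoint_combinator_def Curry_Y_def)
qed

lemma Curry_Y_identity: "Curry_Y \<cdot> Lam x (Var x) =\<^sub>\<beta> Omega"
proof -
  define I where "I = Lam x (Var x)"
  define W where "W = Lam 1 (I \<cdot> (Var 1 \<cdot> Var 1))"
  \<comment> \<open>Here the substituted term \<open>I\<close> is closed, so the binder
    \<open>1\<close> keeps its name.\<close>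
  have "{0, 1} - {1} = {0::nat}"
    by auto
  then have unfold: "Curry_Y \<cdot> I =\<^sub>\<beta> W \<cdot> W"
    using beta_conv.beta[of 0 "Lam 1 (Var 0 \<cdot> (Var 1 \<cdot> Var 1)) \<cdot> Lam 1 (Var 0 \<cdot> (Var 1 \<cdot> Var 1))" I]
    by (simp add: subst_def Curry_Y_def W_def Let_def I_def fresh_name_same)
  have "I \<cdot> (Var 1 \<cdot> Var 1) =\<^sub>\<beta> Var 1 \<cdot> Var 1"
    using beta_conv.beta[of x "Var x" "Var 1 \<cdot> Var 1"] by (simp add: I_def subst_def)
  then have "W =\<^sub>\<beta> Lam 1 (Var 1 \<cdot> Var 1)"
    unfolding W_def by (rule beta_conv.lam)
  \<comment> \<open>The inner binders of \<open>Curry_Y\<close> are named \<open>1\<close> and those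
    of \<open>Omega\<close> are named \<open>0\<close>, so an explicit \<alpha>-step is
    required.\<close>
  moreover have "Lam 1 (Var 1 \<cdot> Var 1) =\<^sub>\<beta> Lam 0 (Var 0 \<cdot> Var 0)"
    using beta_conv.alpha[of 0 "Var 1 \<cdot> Var 1" 1] by (simp add: subst_def)
  ultimately have "W =\<^sub>\<beta> Lam 0 (Var 0 \<cdot> Var 0)"
    by (rule beta_conv.trans)
  then show ?thesis
    using unfold unfolding Omega_def I_def by (meson beta_conv.app beta_conv.trans)
qed

theorem theorem2p3:
  fixes Z :: lterm and x :: var and T :: "(lterm \<times> lterm) set"
  assumes "x \<notin> FV Z"
    and "lambda_theory T"
    and "T \<turnstile> Theta \<cdot> Var x \<cdot> Z \<approx> Var x"
    and "T \<turnstile> Theta \<cdot> Var x \<cdot> Var x \<approx> Z"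
  shows "(\<forall>Y. fixpoint_combinator Y \<longrightarrow> T \<turnstile> Z \<approx> Y \<cdot> Lam x (Var x)) \<and>
         (fixpoint_combinator Curry_Y \<and> T \<turnstile> Z \<approx> Omega)"
proof -
  have "T \<turnstile> Z \<approx> Y \<cdot> Lam x (Var x)" if "fixpoint_combinator Y" for Y
    using subtractive_zero_eq_fixpoint_identity[OF assms(2) FV_Theta assms(1,3,4) that] .
  then show ?thesis
    using fixpoint_combinator_Curry_Y
      lambda_theory_trans[OF assms(2) _ lambda_theory_beta[OF assms(2) Curry_Y_identity]]
    by blast
qed

end
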